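(* Let $\Omega\subset\mathbb{C}^2$ be a nonempty open set and let $\mathcal{X}\subset\operatorname{Hol}(\Omega)$ be a Hausdorff topological vector space satisfying properties P1, P2, P3 (see context). Then a family of polynomials $\mathcal{F}\subset\mathcal{P}_2$ is jointly cyclic in $\mathcal{X}$ if and only if $V(\mathcal{F})\cap\Omega_{max}=\emptyset$ and $\mathfrak{g}(\mathcal{F})$ is cyclic in $\mathcal{X}$. In particular, if $\mathfrak{g}(\mathcal{F})=1$ then $V(\mathcal{F})$ completely determines the joint cyclicity of $\mathcal{F}$: $\mathcal{F}$ is jointly cyclic if and only if $V(\mathcal{F})\cap\Omega_{max}=\emptyset$.
   Context: All vector spaces are over $\mathbb{C}$; topological vector spaces are not assumed locally convex. $\operatorname{Hol}(\Omega)$ is the space of holomorphic functions on $\Omega$. $\mathcal{P}_2$ is the ring of polynomials in two complex variables over $\mathbb{C}$, whose elements are also viewed (by restriction) as functions on $\Omega$. The properties are: P1: $\mathcal{P}_2\subset\mathcal{X}$ and $\mathcal{P}_2$ is dense in $\mathcal{X}$. P2: for each $w\in\Omega$ the evaluation functional $\Lambda_w(F)=F(w)$, $F\in\mathcal{X}$, is continuous. P3: for $j=1,2$ the shift operator $S_jF(z)=z_jF(z)$ maps $\mathcal{X}$ to $\mathcal{X}$ and is continuous. For $F\in\mathcal{X}$, $S[F]:=\overline{\{PF:P\in\mathcal{P}_2\}}$ (closure in $\mathcal{X}$); $F$ is cyclic if $S[F]=\mathcal{X}$. For a family $\mathcal{F}\subset\mathcal{X}$, $S[\mathcal{F}]$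 is the closed linear span in $\mathcal{X}$ of $\bigcup_{F\in\mathcal{F}}S[F]$; $\mathcal{F}$ is jointly cyclic if $S[\mathcal{F}]=\mathcal{X}$. For $\mathcal{F}\subset\mathcal{P}_2$: $V(\mathcal{F}):=\{w\in\mathbb{C}^2:P(w)=0\text{ for all }P\in\mathcal{F}\}$, and $\mathfrak{g}(\mathcal{F})$ is the greatest common divisor of $\mathcal{F}$ in the unique factorization domain $\mathcal{P}_2$ (defined up to a nonzero constant; it is $0$ if $\mathcal{F}$ has no nonzero element). Maximal domain: $\Omega_{max}$ is the set of all $w\in\mathbb{C}^2$ such that the functional $P\mapsto P(w)$ on $\mathcal{P}_2$ extends to a continuous linear functional on $\mathcal{X}$. *)

theory Defs
  imports
    "HOL-Analysis.Analysis"
    "HOL-Library.Function_Algebras"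
    "HOL-Computational_Algebra.Computational_Algebra"
    "HOL-Computational_Algebra.Field_as_Ring"
begin

text \<open>
  A function on \<open>\<Omega> \<subseteq> \<complex>\<^sup>2\<close> is represented by its extension by zero to all of \<open>\<complex>\<^sup>2\<close>.  With this
  convention the vector space operations on functions on \<open>\<Omega>\<close> are the pointwise ones on total
  functions, and two functions on \<open>\<Omega>\<close> coincide iff their representatives are equal.
\<close>

type_synonym cfun = "complex ^ 2 \<Rightarrow> complex"

definition fscale :: "complex \<Rightarrow> cfun \<Rightarrow> cfun" where
  "fscale c F = (\<lambda>z. c * F z)"

interpretation cfun: vector_space fscale
  by unfold_locales (auto simp: fscale_def fun_eq_iff algebra_simps)

definition holomorphic2_at :: "cfun \<Rightarrow> complex ^ 2 \<Rightarrow> bool" where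
  "holomorphic2_at F z \<longleftrightarrow>
     (\<exists>D. (F has_derivative D) (at z) \<and> (\<forall>c v. D (c *s v) = c * D v))"

definition Hol :: "(complex ^ 2) set \<Rightarrow> cfun set" where
  "Hol \<Omega> = {F. (\<forall>z\<in>\<Omega>. holomorphic2_at F z) \<and> (\<forall>z. z \<notin> \<Omega> \<longrightarrow> F z = 0)}"

text \<open>
  \<open>\<complex>[z\<^sub>1, z\<^sub>2]\<close> is the ring \<open>\<complex>[z\<^sub>1][z\<^sub>2]\<close>: the coefficients, of type \<open>complex poly\<close>, are polynomials
  in \<open>z\<^sub>1\<close>, and the outer variable is \<open>z\<^sub>2\<close>.
\<close>

type_synonym poly2 = "complex poly poly"

definition eval2 :: "poly2 \<Rightarrow> complex ^ 2 \<Rightarrow> complex" where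
  "eval2 P z = poly (poly P [:z $ 2:]) (z $ 1)"

definition poly_fun :: "(complex ^ 2) set \<Rightarrow> poly2 \<Rightarrow> cfun" where
  "poly_fun \<Omega> P = (\<lambda>z. if z \<in> \<Omega> then eval2 P z else 0)"

definition zero_locus :: "poly2 set \<Rightarrow> (complex ^ 2) set" where
  "zero_locus \<F> = {w. \<forall>P\<in>\<F>. eval2 P w = 0}"

text \<open>
  A space of functions is given by its topology \<open>X\<close>; the underlying set is \<open>topspace X\<close>.
\<close>

definition fun_tvs :: "cfun topology \<Rightarrow> bool" where
  "fun_tvs X \<longleftrightarrow>
     cfun.subspace (topspace X) \<and>
     continuous_map (prod_topology X X) X (\<lambda>(F, G). F + G) \<and>
     continuous_map (prod_topology euclidean X) X (\<lambda>(c, F). fscale c F)"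

definition shift :: "2 \<Rightarrow> cfun \<Rightarrow> cfun" where
  "shift j F = (\<lambda>z. z $ j * F z)"

definition P1 :: "(complex ^ 2) set \<Rightarrow> cfun topology \<Rightarrow> bool" where
  "P1 \<Omega> X \<longleftrightarrow>
     range (poly_fun \<Omega>) \<subseteq> topspace X \<and> X closure_of (range (poly_fun \<Omega>)) = topspace X"

definition P2 :: "(complex ^ 2) set \<Rightarrow> cfun topology \<Rightarrow> bool" where
  "P2 \<Omega> X \<longleftrightarrow> (\<forall>w\<in>\<Omega>. continuous_map X euclidean (\<lambda>F. F w))"

text \<open>Recall that \<open>continuous_map X X\<close> includes that \<open>topspace X\<close> is mapped into itself.\<close>

definition P3 :: "cfun topology \<Rightarrow> bool" where
  "P3 X \<longleftrightarrow> (\<forall>j. continuous_map X X (shift j))"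

definition invariant_hull :: "cfun topology \<Rightarrow> cfun \<Rightarrow> cfun set" where
  "invariant_hull X F = X closure_of (range (\<lambda>P. (\<lambda>z. eval2 P z * F z)))"

definition cyclic :: "cfun topology \<Rightarrow> cfun \<Rightarrow> bool" where
  "cyclic X F \<longleftrightarrow> invariant_hull X F = topspace X"

definition family_hull :: "cfun topology \<Rightarrow> cfun set \<Rightarrow> cfun set" where
  "family_hull X \<F> = X closure_of (cfun.span (\<Union>F\<in>\<F>. invariant_hull X F))"

definition jointly_cyclic :: "cfun topology \<Rightarrow> cfun set \<Rightarrow> bool" where
  "jointly_cyclic X \<F> \<longleftrightarrow> family_hull X \<F> = topspace X"

definition continuous_functional :: "cfun topology \<Rightarrow> (cfun \<Rightarrow> complex) \<Rightarrow> bool" where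
  "continuous_functional X L \<longleftrightarrow>
     continuous_map X euclidean L \<and>
     (\<forall>F\<in>topspace X. \<forall>G\<in>topspace X. L (F + G) = L F + L G) \<and>
     (\<forall>c. \<forall>F\<in>topspace X. L (fscale c F) = c * L F)"

definition max_domain :: "(complex ^ 2) set \<Rightarrow> cfun topology \<Rightarrow> (complex ^ 2) set" where
  "max_domain \<Omega> X =
     {w. \<exists>L. continuous_functional X L \<and> (\<forall>P. L (poly_fun \<Omega> P) = eval2 P w)}"

end

theory Submission
  imports Defs
begin

text \<open>
  Let \<open>g\<close> be the greatest common divisor of the family \<open>\<F>\<close>, let \<open>N\<close> be the closed invariant subspace
  generated by \<open>\<F>\<close>, and let \<open>J\<close> be the ideal of all \<open>P\<close> with \<open>P g\<close> in \<open>N\<close>.  If \<open>g\<close> is cyclic but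
  \<open>\<F>\<close> is not jointly cyclic, then \<open>J\<close> is proper.  It contains \<open>\<F> / g\<close>, whose members have no common
  divisor, so \<open>J\<close> contains a nonzero polynomial in \<open>z\<^sub>1\<close> alone; splitting off linear factors
  \<open>z\<^sub>1 - a\<close> and \<open>z\<^sub>2 - b\<close> yields \<open>R\<close> outside \<open>J\<close> that both \<open>z\<^sub>1 - a\<close> and \<open>z\<^sub>2 - b\<close> multiply into \<open>J\<close>.
  With \<open>w = (a, b)\<close>, each \<open>P g R\<close> is then congruent to \<open>P(w) g R\<close> modulo the closed subspace \<open>N\<close>, while
  \<open>g R\<close> is not in \<open>N\<close>.  Hence \<open>P \<mapsto> P(w)\<close> is continuous on the polynomials and extends by density, so
  \<open>w\<close> is a common zero of \<open>\<F>\<close> in the maximal domain.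
\<close>

section \<open>Ideals of bivariate polynomials without common divisor\<close>

text \<open>Gauss' lemma: since \<open>content\<close> is multiplicative and \<open>h\<close> is
  primitive, \<open>c\<close> must divide the cofactor of \<open>h\<close>, so it cancels.\<close>

lemma primitive_dvd_smultD:
  fixes h f :: poly2
  assumes "content h = 1" "c \<noteq> 0" "h dvd smult c f"
  shows "h dvd f"
proof -
  obtain q where q: "smult c f = h * q"
    using assms(3) by blast
  have "[:c:] dvd smult c f"
    by (metis dvd_triv_left mult_pCons_left mult_zero_left pCons_0_0 add_0_right)
  then have "c dvd content (h * q)"
    by (simp only: q const_poly_dvd_iff_dvd_content)
  then have "[:c:] dvd q"
    using assms(1) by (simp add: content_mult const_poly_dvd_iff_dvd_content)
  then obtain q' where "q = smult c q'"
    by (auto elim!: dvdE)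
  with q have "smult c f = smult c (h * q')"
    by simp
  then have "f = h * q'"
    using assms(2) smult_cancel by blast
  then show ?thesis
    by simp
qed

text \<open>An element of least \<open>z\<^sub>2\<close>-degree divides every element up to a factor in \<open>z\<^sub>1\<close> (pseudo-division),
  so by Gauss' lemma its primitive part is a common divisor.\<close>

lemma ideal_contains_univariate:
  fixes J S :: "poly2 set"
  assumes add: "\<And>P Q. P \<in> J \<Longrightarrow> Q \<in> J \<Longrightarrow> P + Q \<in> J"
    and mult: "\<And>P Q. P \<in> J \<Longrightarrow> Q * P \<in> J"
    and sub: "S \<subseteq> J"
    and unit: "\<And>d. (\<And>f. f \<in> S \<Longrightarrow> d dvd f) \<Longrightarrow> d dvd 1"
  obtains p where "p \<noteq> 0" "[:p:] \<in> J"
proof -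
  have "\<exists>f. f \<in> J \<and> f \<noteq> 0"
  proof (rule ccontr)
    assume "\<not> ?thesis"
    \<comment> \<open>If \<open>J\<close> had no nonzero element, \<open>0\<close> would be a common
      divisor of \<open>S\<close>.\<close>
    then have "(0::poly2) dvd 1"
      using sub by (intro unit) auto
    then show False by simp
  qed
  then obtain h where h: "h \<in> J" "h \<noteq> 0"
    and least: "\<And>f. f \<in> J \<Longrightarrow> f \<noteq> 0 \<Longrightarrow> degree h \<le> degree f"
    using ex_has_least_nat[of "\<lambda>f. f \<in> J \<and> f \<noteq> 0" _ degree] by blast
  have h_eq: "h = smult (content h) (primitive_part h)"
    by simp
  have "primitive_part h dvd f" if f: "f \<in> S" for f
  proof -
    obtain c q where c: "c \<noteq> 0" "smult c f = h * q + pseudo_mod f h"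
      using pseudo_mod(1)[OF h(2)] by blast
    have "pseudo_mod f h = [:c:] * f + (- q) * h"
      using c(2) by (simp add: algebra_simps)
    also have "\<dots> \<in> J"
      using f sub h(1) by (intro add mult) auto
    finally have "pseudo_mod f h = 0"
      using pseudo_mod(2)[OF h(2), of f] least[of "pseudo_mod f h"] by force
    with c(2) have "smult c f = primitive_part h * smult (content h) q"
      by (metis h_eq add_0_right mult_smult_left mult_smult_right)
    then have "primitive_part h dvd smult c f"
      by (metis dvd_triv_left)
    then show ?thesis
      using primitive_dvd_smultD h(2) c(1) content_primitive_part by blast
  qed
  then have "primitive_part h dvd 1"
    by (rule unit)
  then have "degree (primitive_part h) = 0"
    by (metis dvd_imp_degree_le degree_1 le_zero_eq one_neq_zero)
  then have "degree h = 0"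
    by simp
  then obtain p where "h = [:p:]"
    by (metis degree_eq_zeroE)
  with h that show thesis
    by auto
qed

text \<open>Stripping off linear factors one at a time until just before the product falls into \<open>J\<close>.\<close>

lemma linear_factor_annihilates:
  fixes J :: "'a::comm_ring_1 set" and \<phi> :: "complex poly \<Rightarrow> 'a"
  assumes hom: "\<And>p q. \<phi> (p * q) = \<phi> p * \<phi> q"
    and const: "\<And>c x. c \<noteq> 0 \<Longrightarrow> \<phi> [:c:] * x \<in> J \<Longrightarrow> x \<in> J"
    and "p \<noteq> 0" "R \<notin> J" "\<phi> p * R \<in> J"
  obtains a s where "\<phi> s * R \<notin> J" "\<phi> [:- a, 1:] * (\<phi> s * R) \<in> J"
  using assms(3-5)
proof (induction "degree p" arbitrary: p R thesis)
  \<comment> \<open>A nonzero constant can be cancelled by \<open>const\<close>, which contradicts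
    \<open>R \<notin> J\<close>.\<close>
  case 0
  then obtain c where "p = [:c:]"
    by (metis degree_eq_zeroE)
  with 0 const show ?case
    by (metis pCons_eq_0_iff)
next
  case (Suc n)
  then have "\<not> constant (poly p)"
    by (simp add: constant_degree)
  then obtain a where "poly p a = 0"
    using fundamental_theorem_of_algebra by blast
  then obtain q where q: "p = [:- a, 1:] * q"
    by (metis poly_eq_0_iff_dvd dvdE)
  with Suc.prems(2) have q0: "q \<noteq> 0"
    by auto
  show ?case
  \<comment> \<open>If \<open>q\<close> still multiplies \<open>R\<close> into \<open>J\<close>,
    induct on \<open>q\<close>; otherwise \<open>s = q\<close> is the stopping point.\<close>
  proof (cases "\<phi> q * R \<in> J")
    case True
    have "degree p = Suc (degree q)"
      using q0 unfolding q by (subst degree_mult_eq) auto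
    then show ?thesis
      using Suc.hyps(1)[of q R] Suc.hyps(2) Suc.prems(1,3) True q0 by (metis Suc_inject)
  next
    case False
    moreover have "\<phi> [:- a, 1:] * (\<phi> q * R) \<in> J"
      using Suc.prems(4) q by (simp add: hom[symmetric] mult.assoc[symmetric] del: mult_pCons_left)
    ultimately show ?thesis
      by (rule Suc.prems(1))
  qed
qed

text \<open>Synthetic division twice: by \<open>z2 - b\<close>, leaving a remainder in
  \<open>z1\<close> alone, then of that remainder by \<open>z1 - a\<close>.\<close>

lemma poly2_minus_value_in_maximal_ideal:
  fixes P :: poly2
  obtains A B where "P - [:[:poly (poly P [:b:]) a:]:] = [:[:- a, 1:]:] * A + [:[:- b:], 1:] * B"
proof -
  have 1: "P = [:- [:b:], 1:] * synthetic_div P [:b:] + [:poly P [:b:]:]"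
    by (metis synthetic_div_correct')
  have "poly P [:b:] = [:- a, 1:] * synthetic_div (poly P [:b:]) a + [:poly (poly P [:b:]) a:]"
    by (metis synthetic_div_correct')
  then have "[:poly P [:b:]:] = [:[:- a, 1:]:] * [:synthetic_div (poly P [:b:]) a:] + [:[:poly (poly P [:b:]) a:]:]"
    by simp
  with 1 have "P - [:[:poly (poly P [:b:]) a:]:] =
      [:[:- a, 1:]:] * [:synthetic_div (poly P [:b:]) a:] + [:[:- b:], 1:] * synthetic_div P [:b:]"
    by (simp add: algebra_simps)
  then show thesis
    by (rule that)
qed

text \<open>This map embeds one-variable polynomials as polynomials in the outer variable
  \<open>z2\<close>; multiplicativity lets \<open>linear_factor_annihilates\<close> act on that
  variable.\<close>

lemma map_poly_const_mult:
  "map_poly (\<lambda>c. [:c:]) (p * q) = map_poly (\<lambda>c. [:c:]) p * map_poly (\<lambda>c. [:c:]) (q :: complex poly)"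
proof (rule poly_eqI)
  fix n
  have "[:\<Sum>i\<le>n. f i:] = (\<Sum>i\<le>n. [:f i:])" for f :: "nat \<Rightarrow> complex"
    by (rule poly_eqI) (simp add: coeff_sum coeff_pCons split: nat.split)
  then show "coeff (map_poly (\<lambda>c. [:c:]) (p * q)) n =
      coeff (map_poly (\<lambda>c. [:c:]) p * map_poly (\<lambda>c. [:c:]) q) n"
    by (simp add: coeff_map_poly coeff_mult mult.commute)
qed

text \<open>The associated-prime form of the Nullstellensatz for \<open>J\<close>: \<open>R\<close> spans a copy of the residue field
  at \<open>(a, b)\<close> in the quotient by \<open>J\<close>.\<close>

lemma proper_ideal_associated_point:
  fixes J S :: "poly2 set"
  assumes add: "\<And>P Q. P \<in> J \<Longrightarrow> Q \<in> J \<Longrightarrow> P + Q \<in> J"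
    and mult: "\<And>P Q. P \<in> J \<Longrightarrow> Q * P \<in> J"
    and sub: "S \<subseteq> J"
    and unit: "\<And>d. (\<And>f. f \<in> S \<Longrightarrow> d dvd f) \<Longrightarrow> d dvd 1"
    and proper: "1 \<notin> J"
  obtains w :: "complex ^ 2" and R where "R \<notin> J" "\<forall>P. (P - [:[:eval2 P w:]:]) * R \<in> J"
    "w \<in> zero_locus J"
proof -
  have const: "x \<in> J" if "c \<noteq> 0" "[:[:c:]:] * x \<in> J" for c :: complex and x
  proof -
    have "[:[:1 / c:]:] * ([:[:c:]:] * x) \<in> J"
      by (intro mult that)
    then show ?thesis
      using that(1) by (simp flip: one_pCons)
  qed
  obtain p where p: "p \<noteq> 0" "[:p:] \<in> J"
    using ideal_contains_univariate[of J S] add mult sub unit by metis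
  \<comment> \<open>First pass, in \<open>z1\<close>: \<open>p\<close> multiplies \<open>1\<close>
    into \<open>J\<close>, and \<open>1\<close> is outside \<open>J\<close>.\<close>
  obtain a s where s: "[:s:] * 1 \<notin> J" "[:[:- a, 1:]:] * ([:s:] * 1) \<in> J"
    by (rule linear_factor_annihilates[of "\<lambda>p. [:p:]" J p 1]) (use p proper const in auto)
  define R where "R = [:s:]"
  have R: "R \<notin> J" "[:[:- a, 1:]:] * R \<in> J"
    using s by (simp_all add: R_def)
  obtain f where f: "f \<in> S" "\<not> [:[:- a, 1:]:] dvd f"
  proof -
    have "\<not> [:[:- a, 1:]:] dvd (1::poly2)"
      by (auto simp: is_unit_poly_iff)
    then show thesis
      using unit that by blast
  qed
  have const_map: "x \<in> J" if "c \<noteq> 0" "map_poly (\<lambda>c. [:c:]) [:c:] * x \<in> J" for c :: complex and x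
    using that const[of c x] by (simp add: map_poly_pCons)
  \<comment> \<open>\<open>q\<close> is \<open>f\<close> restricted to the line
    \<open>z1 = a\<close>, nonzero because \<open>z1 - a\<close> does not divide \<open>f\<close>.
    As \<open>z1 - a\<close> multiplies \<open>R\<close> into \<open>J\<close>, so does
    \<open>q(z2)\<close>, which is congruent to \<open>f\<close> modulo
    \<open>z1 - a\<close>.\<close>
  define q where "q = map_poly (\<lambda>c. poly c a) f"
  let ?q = "map_poly (\<lambda>c. [:c:]) q"
  have dvd_diff: "[:[:- a, 1:]:] dvd f - ?q"
    by (subst const_poly_dvd_iff) (simp add: q_def coeff_map_poly flip: poly_eq_0_iff_dvd)
  have q0: "q \<noteq> 0"
    using dvd_diff f(2) by auto
  have qR: "?q * R \<in> J"
  proof -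
    obtain d where "f - ?q = [:[:- a, 1:]:] * d"
      using dvd_diff by blast
    then have "?q * R = R * f + (- d) * ([:[:- a, 1:]:] * R)"
      by (simp add: algebra_simps del: mult_pCons_left mult_pCons_right)
    also have "\<dots> \<in> J"
      using f sub R(2) by (blast intro: add[OF mult mult])
    finally show ?thesis .
  qed
  \<comment> \<open>Second pass, in \<open>z2\<close>, starting from \<open>R\<close>. Multiplying
    by \<open>t(z2)\<close> preserves annihilation by \<open>z1 - a\<close> modulo
    \<open>J\<close>.\<close>
  obtain b t where
    t: "map_poly (\<lambda>c. [:c:]) t * R \<notin> J"
       "map_poly (\<lambda>c. [:c:]) [:- b, 1:] * (map_poly (\<lambda>c. [:c:]) t * R) \<in> J"
    by (rule linear_factor_annihilates[OF map_poly_const_mult const_map q0 R(1) qR])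
  define T where "T = map_poly (\<lambda>c. [:c:]) t * R"
  have T: "T \<notin> J" "[:[:- b:], 1:] * T \<in> J"
    using t by (simp_all add: T_def map_poly_pCons one_pCons)
  have Ta: "[:[:- a, 1:]:] * T \<in> J"
    using mult[OF R(2), of "map_poly (\<lambda>c. [:c:]) t"]
    by (simp add: T_def algebra_simps del: mult_pCons_left mult_pCons_right)
  define w :: "complex ^ 2" where "w = (\<chi> i. if i = 1 then a else b)"
  have w: "eval2 P w = poly (poly P [:b:]) a" for P
    by (simp add: eval2_def w_def)
  have key: "(P - [:[:eval2 P w:]:]) * T \<in> J" for P
  proof -
    obtain A B where "P - [:[:eval2 P w:]:] = [:[:- a, 1:]:] * A + [:[:- b:], 1:] * B"
      using poly2_minus_value_in_maximal_ideal[of P b a] unfolding w by blast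
    then have "(P - [:[:eval2 P w:]:]) * T = A * ([:[:- a, 1:]:] * T) + B * ([:[:- b:], 1:] * T)"
      by (simp only: distrib_right distrib_left mult_ac)
    also have "\<dots> \<in> J"
      by (rule add[OF mult[OF Ta] mult[OF T(2)]])
    finally show ?thesis .
  qed
  moreover have "eval2 P w = 0" if "P \<in> J" for P
  proof (rule ccontr)
    assume nz: "eval2 P w \<noteq> 0"
    \<comment> \<open>Modulo \<open>J\<close>, the product \<open>P * T\<close> is both zero and
      \<open>P(w)\<close> times \<open>T\<close>.\<close>
    have "[:[:eval2 P w:]:] * T = T * P + (- 1) * ((P - [:[:eval2 P w:]:]) * T)"
      by (simp add: algebra_simps del: mult_pCons_left mult_pCons_right minus_pCons)
    also have "\<dots> \<in> J"
      by (rule add[OF mult[OF that] mult[OF key]])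
    finally show False
      using const nz T(1) by blast
  qed
  then have "w \<in> zero_locus J"
    by (simp add: zero_locus_def)
  ultimately show thesis
    using that T(1) by blast
qed

section \<open>Topological vector spaces of functions\<close>

lemma fun_tvs_subspace: "fun_tvs X \<Longrightarrow> cfun.subspace (topspace X)"
  by (simp add: fun_tvs_def)

lemma continuous_map_fun_add:
  assumes "fun_tvs X" "continuous_map Y X f" "continuous_map Y X g"
  shows "continuous_map Y X (\<lambda>x. f x + g x)"
proof -
  have "continuous_map Y (prod_topology X X) (\<lambda>x. (f x, g x))"
    using assms by (simp add: continuous_map_pairedI)
  from continuous_map_compose[OF this, of X "\<lambda>(F, G). F + G"] show ?thesis
    using assms(1) by (simp add: fun_tvs_def o_def)
qed

lemma continuous_map_fscale:
  assumes "fun_tvs X" "continuous_map Y X f"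
  shows "continuous_map Y X (\<lambda>x. fscale c (f x))"
proof -
  have "continuous_map Y (prod_topology euclidean X) (\<lambda>x. (c, f x))"
    using assms by (simp add: continuous_map_pairedI)
  from continuous_map_compose[OF this, of X "\<lambda>(c, F). fscale c F"] show ?thesis
    using assms(1) by (simp add: fun_tvs_def o_def)
qed

lemma closure_of_invariant:
  assumes "continuous_map X X f" "f ` S \<subseteq> S"
  shows "f ` (X closure_of S) \<subseteq> X closure_of S"
  using continuous_map_image_closure_subset[OF assms(1)] closure_of_mono[OF assms(2)] by blast

text \<open>Continuous operations preserve closures; for addition, the closure of
  \<open>S \<times> S\<close> is the product of the closures.\<close>

lemma subspace_closure_of:
  assumes X: "fun_tvs X" and S: "cfun.subspace S" "S \<subseteq> topspace X"
  shows "cfun.subspace (X closure_of S)"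
proof (rule cfun.subspaceI)
  show "0 \<in> X closure_of S"
    using S closure_of_subset cfun.subspace_0 by blast
next
  fix F G assume "F \<in> X closure_of S" "G \<in> X closure_of S"
  then have "(F, G) \<in> prod_topology X X closure_of (S \<times> S)"
    by (simp add: closure_of_Times)
  moreover have "continuous_map (prod_topology X X) X (\<lambda>(F, G). F + G)"
    using X by (simp add: fun_tvs_def)
  ultimately have "(\<lambda>(F, G). F + G) (F, G) \<in> X closure_of ((\<lambda>(F, G). F + G) ` (S \<times> S))"
    using continuous_map_image_closure_subset by blast
  moreover have "(\<lambda>(F, G). F + G) ` (S \<times> S) \<subseteq> S"
    using S(1) cfun.subspace_add by auto
  ultimately show "F + G \<in> X closure_of S"
    using closure_of_mono by fastforce
next
  fix c F assume "F \<in> X closure_of S"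
  moreover have "fscale c ` (X closure_of S) \<subseteq> X closure_of S"
    using S(1) by (intro closure_of_invariant continuous_map_fscale[OF X] continuous_map_id[unfolded id_def])
      (auto simp: cfun.subspace_scale)
  ultimately show "fscale c F \<in> X closure_of S"
    by blast
qed

lemma continuous_map_prod_nhd:
  assumes "continuous_map (prod_topology X Y) Z f" "openin Z T"
    and "x \<in> topspace X" "y \<in> topspace Y" "f (x, y) \<in> T"
  obtains U V where "openin X U" "openin Y V" "x \<in> U" "y \<in> V"
    "\<And>u v. u \<in> U \<Longrightarrow> v \<in> V \<Longrightarrow> f (u, v) \<in> T"
proof -
  let ?S = "{p \<in> topspace (prod_topology X Y). f p \<in> T}"
  have "openin (prod_topology X Y) ?S"
    using assms(1,2) by (rule openin_continuous_map_preimage)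
  moreover have "(x, y) \<in> ?S"
    using assms by simp
  ultimately have "\<exists>U V. openin X U \<and> openin Y V \<and> x \<in> U \<and> y \<in> V \<and> U \<times> V \<subseteq> ?S"
    by (rule openin_prod_topology_alt[THEN iffD1, rule_format])
  with that show thesis
    by blast
qed

text \<open>Continuity of scalar multiplication at \<open>(0, 0)\<close> gives a disc
  \<open>A\<close> and a neighbourhood \<open>V\<close>; shrinking \<open>V\<close> trades the disc
  for the unit disc.\<close>

lemma fun_tvs_balanced_nhd:
  assumes X: "fun_tvs X" and T: "openin X T" "0 \<in> T"
  obtains U where "openin X U" "0 \<in> U" "\<And>c F. cmod c \<le> 1 \<Longrightarrow> F \<in> U \<Longrightarrow> fscale c F \<in> T"
proof -
  let ?m = "\<lambda>(c, F). fscale c F"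
  have m: "continuous_map (prod_topology euclidean X) X ?m" and m0: "?m (0, 0) \<in> T"
    and zero: "(0::complex) \<in> topspace euclidean" "0 \<in> topspace X"
    using X T(2) cfun.subspace_0[OF fun_tvs_subspace[OF X]] by (simp_all add: fun_tvs_def)
  obtain A V where "openin euclidean A" and A: "0 \<in> A" and V: "openin X V" "0 \<in> V"
    and AV: "\<And>c F. c \<in> A \<Longrightarrow> F \<in> V \<Longrightarrow> ?m (c, F) \<in> T"
    by (rule continuous_map_prod_nhd[OF m T(1) zero m0]) blast
  then have "open A"
    by simp
  obtain \<delta> where \<delta>: "\<delta> > 0" "ball 0 \<delta> \<subseteq> A"
    using \<open>open A\<close> A open_contains_ball by blast
  \<comment> \<open>\<open>U\<close> is \<open>V\<close> scaled by \<open>\<delta> / 2\<close>; the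
    half keeps the scalars strictly inside the open ball of radius \<open>\<delta>\<close>.\<close>
  define U where "U = {F \<in> topspace X. fscale (of_real (2 / \<delta>)) F \<in> V}"
  show thesis
  proof
    show "openin X U"
      unfolding U_def
      using V(1) continuous_map_fscale[OF X continuous_map_id[unfolded id_def]] openin_continuous_map_preimage
      by blast
    show "0 \<in> U"
      using V cfun.subspace_0[OF fun_tvs_subspace[OF X]] by (simp add: U_def)
    fix c F assume c: "cmod c \<le> 1" and F: "F \<in> U"
    have "c * of_real (\<delta> / 2) \<in> A"
    proof -
      have "cmod (c * of_real (\<delta> / 2)) \<le> 1 * (\<delta> / 2)"
        unfolding norm_mult using c \<delta>(1) by (intro mult_mono) auto
      then show ?thesis
        using \<delta> by auto
    qed
    with F have "fscale (c * of_real (\<delta> / 2)) (fscale (of_real (2 / \<delta>)) F) \<in> T"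
      using AV[of "c * of_real (\<delta> / 2)" "fscale (of_real (2 / \<delta>)) F"] by (simp add: U_def)
    then show "fscale c F \<in> T"
      using \<delta>(1) by simp
  qed
qed

text \<open>Gives continuity of the coefficient of \<open>Q\<close> modulo \<open>N\<close>. If
  \<open>|c| \<ge> 1\<close>, dividing by \<open>c\<close> stays in the neighbourhood
  \<open>T\<close> of \<open>0\<close>, and subtracting the result from \<open>Q\<close> leaves a
  multiple of \<open>n\<close>, although \<open>T\<close> forces it outside
  \<open>N\<close>.\<close>

lemma closed_subspace_coefficient_bound:
  assumes X: "fun_tvs X" and N: "closedin X N" "cfun.subspace N" and Q: "Q \<in> topspace X" "Q \<notin> N"
  obtains U where "openin X U" "0 \<in> U" "\<And>c n. n \<in> N \<Longrightarrow> fscale c Q + n \<in> U \<Longrightarrow> cmod c < 1"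
proof -
  define T where "T = {F \<in> topspace X. Q + fscale (- 1) F \<in> topspace X - N}"
  have "continuous_map X X (\<lambda>F. Q + fscale (- 1) F)"
    using Q X by (intro continuous_map_fun_add continuous_map_fscale) auto
  then have "openin X T"
    unfolding T_def using N(1) openin_continuous_map_preimage by blast
  moreover have "0 \<in> T"
    using Q cfun.subspace_0[OF fun_tvs_subspace[OF X]] by (simp add: T_def)
  ultimately obtain U where U: "openin X U" "0 \<in> U"
    "\<And>c F. cmod c \<le> 1 \<Longrightarrow> F \<in> U \<Longrightarrow> fscale c F \<in> T"
    using fun_tvs_balanced_nhd[OF X] by metis
  have "cmod c < 1" if "n \<in> N" "fscale c Q + n \<in> U" for c n
  proof (rule ccontr)
    assume "\<not> cmod c < 1"
    then have c: "cmod c \<ge> 1" "c \<noteq> 0"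
      by auto
    then have "fscale (1 / c) (fscale c Q + n) \<in> T"
      using U(3) that(2) by (simp add: norm_divide)
    then have "Q + fscale (- 1) (fscale (1 / c) (fscale c Q + n)) \<notin> N"
      by (simp add: T_def)
    moreover have "Q + fscale (- 1) (fscale (1 / c) (fscale c Q + n)) = fscale (- 1 / c) n"
      using c(2) by (simp add: cfun.scale_right_distrib)
    ultimately show False
      using cfun.subspace_scale[OF N(2) that(1)] by metis
  qed
  with U that show thesis
    by blast
qed

section \<open>Extension of functionals from a dense subspace\<close>

text \<open>Boundedness on \<open>W\<close> makes \<open>l\<close> uniformly continuous,
  completeness of the complex numbers supplies limits off \<open>D\<close>, and density transfers
  linearity.\<close>

lemma dense_subspace_functional_extends:
  assumes X: "fun_tvs X"
    and D: "cfun.subspace D" "D \<subseteq> topspace X" "X closure_of D = topspace X"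
    and l_add: "\<And>F G. F \<in> D \<Longrightarrow> G \<in> D \<Longrightarrow> l (F + G) = l F + l G"
    and l_scale: "\<And>c F. F \<in> D \<Longrightarrow> l (fscale c F) = c * l F"
    and W: "openin X W" "0 \<in> W" "\<And>F. F \<in> D \<Longrightarrow> F \<in> W \<Longrightarrow> cmod (l F) < 1"
  obtains L where "continuous_functional X L" "\<And>F. F \<in> D \<Longrightarrow> L F = l F"
proof -
  have osc: "\<exists>V. openin X V \<and> x \<in> V \<and> (\<forall>F\<in>D \<inter> V. \<forall>G\<in>D \<inter> V. dist (l F) (l G) < e)"
    if x: "x \<in> topspace X" and e: "e > 0" for x and e :: real
  proof -
    \<comment> \<open>The factor \<open>1 / e\<close> turns the bound \<open>1\<close> on
      \<open>W\<close> into the bound \<open>e\<close> on differences.\<close>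
    let ?d = "\<lambda>p. fscale (of_real (1 / e)) (fst p + fscale (- 1) (snd p))"
    have d: "continuous_map (prod_topology X X) X ?d"
      by (intro continuous_map_fscale[OF X] continuous_map_fun_add[OF X]
          continuous_map_fst continuous_map_snd)
    have d0: "?d (x, x) \<in> W"
    proof -
      have "?d (x, x) = 0"
        by (auto simp: fscale_def fun_eq_iff)
      with W(2) show ?thesis
        by simp
    qed
    obtain V1 V2 where V: "openin X V1" "openin X V2" "x \<in> V1" "x \<in> V2"
      and VW: "\<And>F G. F \<in> V1 \<Longrightarrow> G \<in> V2 \<Longrightarrow> ?d (F, G) \<in> W"
      by (rule continuous_map_prod_nhd[OF d W(1) x x d0]) blast
    have "\<forall>F\<in>D \<inter> (V1 \<inter> V2). \<forall>G\<in>D \<inter> (V1 \<inter> V2). dist (l F) (l G) < e"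
    proof (intro ballI)
      fix F G assume FG: "F \<in> D \<inter> (V1 \<inter> V2)" "G \<in> D \<inter> (V1 \<inter> V2)"
      have inW: "?d (F, G) \<in> W"
        using FG VW by blast
      have inD: "F + fscale (- 1) G \<in> D"
        using FG D(1) by (intro cfun.subspace_add cfun.subspace_scale) auto
      have "l (F + fscale (- 1) G) = l F + (- 1) * l G"
        using l_add[of F "fscale (- 1) G"] l_scale[of G "- 1"] cfun.subspace_scale[OF D(1), of G "- 1"] FG
        by simp
      then have "l (?d (F, G)) = of_real (1 / e) * (l F + (- 1) * l G)"
        by (simp only: fst_conv snd_conv l_scale[OF inD])
      moreover have "cmod (l (?d (F, G))) < 1"
        using inW inD D(1) by (intro W(3)) (auto intro: cfun.subspace_scale)
      ultimately have "cmod (of_real (1 / e) * (l F - l G)) < 1"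
        by simp
      then show "dist (l F) (l G) < e"
        using e by (simp add: norm_mult norm_divide dist_norm field_simps)
    qed
    moreover have "openin X (V1 \<inter> V2)" "x \<in> V1 \<inter> V2"
      using V by auto
    ultimately show ?thesis
      by blast
  qed
  have cont: "continuous_map (subtopology X D) euclidean l"
    unfolding continuous_map_def
  proof (intro conjI allI impI)
    fix U :: "complex set" assume U: "openin euclidean U"
    show "openin (subtopology X D) {x \<in> topspace (subtopology X D). l x \<in> U}"
    proof (subst openin_subopen, intro ballI)
      fix x assume x: "x \<in> {x \<in> topspace (subtopology X D). l x \<in> U}"
      then obtain e where e: "e > 0" "ball (l x) e \<subseteq> U"
        using U by (auto simp: open_contains_ball simp flip: open_openin)
      obtain V where V: "openin X V" "x \<in> V" "\<forall>F\<in>D \<inter> V. \<forall>G\<in>D \<inter> V. dist (l F) (l G) < e"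
        using osc[of x e] x e by auto
      have "V \<inter> D \<subseteq> {x \<in> topspace (subtopology X D). l x \<in> U}"
        using V x e openin_subset[OF V(1)] by (auto simp: subset_iff)
      then show "\<exists>T. openin (subtopology X D) T \<and> x \<in> T \<and>
          T \<subseteq> {x \<in> topspace (subtopology X D). l x \<in> U}"
        using V x openin_subtopology_Int[OF V(1), of D] by (intro exI[of _ "V \<inter> D"]) auto
    qed
  qed auto
  \<comment> \<open>The image filter is Cauchy by \<open>osc\<close> and proper by density; since
    \<open>x\<close> is not in \<open>D\<close>, puncturing at \<open>x\<close> removes
    nothing.\<close>
  have lim: "\<exists>z. limitin euclidean l z (atin_within X x D)" if x: "x \<in> topspace X - D" for x
  proof -
    let ?F = "filtermap l (atin_within X x D)"
    have "cauchy_filter ?F"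
      unfolding cauchy_filter_metric_filtermap
    proof (intro allI impI)
      fix e :: real assume "e > 0"
      then obtain V where V: "openin X V" "x \<in> V" "\<forall>F\<in>D \<inter> V. \<forall>G\<in>D \<inter> V. dist (l F) (l G) < e"
        using osc[of x e] x by auto
      then have "eventually (\<lambda>F. F \<in> D \<inter> V) (atin_within X x D)"
        by (auto simp: eventually_atin_within)
      then show "\<exists>P. eventually P (atin_within X x D) \<and> (\<forall>F G. P F \<and> P G \<longrightarrow> dist (l F) (l G) < e)"
        using V(3) by blast
    qed
    moreover have "?F \<noteq> bot"
    proof -
      have "x \<in> X closure_of D"
        using x D(3) by auto
      then have "\<not> eventually (\<lambda>_. False) (atin_within X x D)"
        using x by (auto simp: eventually_atin_within in_closure_of)
      then show ?thesis
        by (simp add: trivial_limit_def eventually_filtermap)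
    qed
    ultimately obtain z where "?F \<le> nhds z"
      using cauchy_filter_complete_converges[of ?F UNIV] complete_UNIV by auto
    then have "(l \<longlongrightarrow> z) (atin_within X x D)"
      by (simp add: filterlim_def)
    then show ?thesis
      by (auto simp: limitin_canonical_iff)
  qed
  obtain L where L0: "continuous_map (subtopology X (topspace X)) euclidean L"
    and LD: "\<And>F. F \<in> D \<Longrightarrow> L F = l F"
    by (rule continuous_map_extension_pointwise_alt[of euclidean D "topspace X" X l])
      (use D cont lim in \<open>auto simp: regular_space_euclidean\<close>)
  then have L: "continuous_map X euclidean L"
    by simp
  \<comment> \<open>Both sides of each linearity identity are continuous into a Hausdorff space and
    agree on a dense set.\<close>
  have H: "Hausdorff_space (euclidean :: complex topology)"
    by simp
  have "L (F + G) = L F + L G" if "F \<in> topspace X" "G \<in> topspace X" for F G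
  proof -
    have cp: "continuous_map (prod_topology X X) euclidean (\<lambda>p. L (fst p + snd p))"
      using continuous_map_compose[OF continuous_map_fun_add[OF X continuous_map_fst continuous_map_snd] L]
      by (simp add: o_def)
    have cs: "continuous_map (prod_topology X X) euclidean (\<lambda>p. L (fst p) + L (snd p))"
      using continuous_map_compose[OF continuous_map_fst L] continuous_map_compose[OF continuous_map_snd L]
      by (intro continuous_map_add) (simp_all add: o_def)
    have "(F, G) \<in> prod_topology X X closure_of (D \<times> D)"
      using that D(3) by (simp add: closure_of_Times)
    from forall_in_closure_of_eq[OF this H cp cs] show ?thesis
      using LD l_add D(1) by (auto simp: cfun.subspace_add)
  qed
  moreover have "L (fscale c F) = c * L F" if "F \<in> topspace X" for c F
  proof -
    have cp: "continuous_map X euclidean (\<lambda>F. L (fscale c F))"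
      using continuous_map_compose[OF continuous_map_fscale[OF X continuous_map_id[unfolded id_def]] L]
      by (simp add: o_def)
    have cs: "continuous_map X euclidean (\<lambda>F. c * L F)"
      using continuous_map_compose[OF L, of euclidean "(*) c"]
      by (simp add: o_def continuous_on_mult_left)
    have "F \<in> X closure_of D"
      using that D(3) by simp
    from forall_in_closure_of_eq[OF this H cp cs] show ?thesis
      using LD l_scale D(1) by (auto simp: cfun.subspace_scale)
  qed
  ultimately have "continuous_functional X L"
    using L by (simp add: continuous_functional_def)
  with LD that show thesis
    by blast
qed

section \<open>Polynomial multipliers\<close>

lemma eval2_simps [simp]:
  "eval2 0 z = 0" "eval2 1 z = 1" "eval2 (P + Q) z = eval2 P z + eval2 Q z"
  "eval2 (P - Q) z = eval2 P z - eval2 Q z"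
  "eval2 (P * Q) z = eval2 P z * eval2 Q z" "eval2 [:[:c:]:] z = c"
  by (simp_all add: eval2_def)

lemma poly_fun_simps:
  "poly_fun \<Omega> (P + Q) = poly_fun \<Omega> P + poly_fun \<Omega> Q"
  "poly_fun \<Omega> (P * Q) = (\<lambda>z. eval2 P z * poly_fun \<Omega> Q z)"
  "poly_fun \<Omega> ([:[:c:]:] * P) = fscale c (poly_fun \<Omega> P)"
  "poly_fun \<Omega> (P - Q) = poly_fun \<Omega> P + fscale (- 1) (poly_fun \<Omega> Q)"
  by (auto simp: poly_fun_def fscale_def fun_eq_iff simp del: mult_pCons_left)

lemma subspace_range_poly_fun: "cfun.subspace (range (poly_fun \<Omega>))"
proof (rule cfun.subspaceI)
  show "0 \<in> range (poly_fun \<Omega>)"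
    by (rule range_eqI[of _ _ 0]) (auto simp: poly_fun_def)
qed (auto simp flip: poly_fun_simps)

text \<open>Horner's scheme in both variables: \<open>shift 1\<close> builds the coefficients and
  \<open>shift 2\<close> the outer polynomial.\<close>

lemma continuous_map_eval2_mult:
  assumes X: "fun_tvs X" and shift: "P3 X"
  shows "continuous_map X X (\<lambda>F z. eval2 P z * F z)"
proof -
  have sh: "continuous_map X X (\<lambda>F. shift j (f F))" if "continuous_map X X f" for j f
    using continuous_map_compose[OF that, of X "shift j"] shift by (simp add: P3_def o_def)
  have zero: "continuous_map X X (\<lambda>F. 0)"
    using cfun.subspace_0[OF fun_tvs_subspace[OF X]] by simp
  have inner: "continuous_map X X (\<lambda>F z. poly c (z $ 1) * F z)" for c
  proof (induction c)
    case 0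
    then show ?case using zero by (simp add: zero_fun_def)
  next
    case (pCons a c)
    have "(\<lambda>F z. poly (pCons a c) (z $ 1) * F z) =
        (\<lambda>F. fscale a F + shift 1 (\<lambda>z. poly c (z $ 1) * F z))"
      by (auto simp: fscale_def shift_def fun_eq_iff algebra_simps)
    then show ?case
      using continuous_map_fun_add[OF X continuous_map_fscale[OF X continuous_map_id[unfolded id_def]] sh[OF pCons(2)]]
      by simp
  qed
  show ?thesis
  proof (induction P)
    case 0
    then show ?case using zero by (simp add: zero_fun_def)
  next
    case (pCons c P)
    have "(\<lambda>F z. eval2 (pCons c P) z * F z) =
        (\<lambda>F. (\<lambda>z. poly c (z $ 1) * F z) + shift 2 (\<lambda>z. eval2 P z * F z))"
      by (auto simp: eval2_def shift_def fun_eq_iff algebra_simps)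
    then show ?case
      using continuous_map_fun_add[OF X inner sh[OF pCons(2)]] by simp
  qed
qed

section \<open>Closed invariant subspaces\<close>

lemma invariant_hull_least:
  assumes "closedin X N" "\<And>P. (\<lambda>z. eval2 P z * F z) \<in> N"
  shows "invariant_hull X F \<subseteq> N"
  unfolding invariant_hull_def using assms by (intro closure_of_minimal) auto

lemma family_hull_least:
  assumes "closedin X N" "cfun.subspace N" "\<And>F. F \<in> \<F> \<Longrightarrow> invariant_hull X F \<subseteq> N"
  shows "family_hull X \<F> \<subseteq> N"
  unfolding family_hull_def using assms
  by (intro closure_of_minimal cfun.span_minimal) auto

lemma closedin_family_hull: "closedin X (family_hull X \<F>)"
  by (simp add: family_hull_def)

lemma span_hulls_subset_topspace:
  assumes "fun_tvs X"
  shows "cfun.span (\<Union>F\<in>\<F>. invariant_hull X F) \<subseteq> topspace X"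
  using fun_tvs_subspace[OF assms]
  by (intro cfun.span_minimal UN_least) (simp_all add: invariant_hull_def closure_of_subset_topspace)

lemma subspace_family_hull: "fun_tvs X \<Longrightarrow> cfun.subspace (family_hull X \<F>)"
  unfolding family_hull_def
  by (intro subspace_closure_of span_hulls_subset_topspace cfun.subspace_span)

text \<open>Invariance passes from the polynomial multiples of each \<open>F\<close> to their
  closure, then to the span, then to its closure.\<close>

lemma family_hull_eval2_mult:
  assumes X: "fun_tvs X" "P3 X" and G: "G \<in> family_hull X \<F>"
  shows "(\<lambda>z. eval2 P z * G z) \<in> family_hull X \<F>"
proof -
  let ?m = "\<lambda>F z. eval2 P z * F z :: complex"
  note cont = continuous_map_eval2_mult[OF X, of P]
  let ?U = "\<Union>F\<in>\<F>. invariant_hull X F"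
  have hull: "?m ` invariant_hull X F \<subseteq> invariant_hull X F" for F
    unfolding invariant_hull_def
  proof (rule closure_of_invariant[OF cont], clarify)
    fix Q
    show "(\<lambda>z. eval2 P z * (eval2 Q z * F z)) \<in> range (\<lambda>P z. eval2 P z * F z)"
      by (rule range_eqI[of _ _ "P * Q"]) (simp add: mult.assoc)
  qed
  have "?m H \<in> cfun.span ?U" if "H \<in> cfun.span ?U" for H
    using that
  proof (induction rule: cfun.span_induct_alt)
    case base
    then show ?case
      using cfun.span_zero by (simp add: zero_fun_def)
  next
    case (step c F H)
    have "?m (fscale c F + H) = fscale c (?m F) + ?m H"
      by (auto simp: fscale_def fun_eq_iff algebra_simps)
    moreover have "?m F \<in> ?U"
      using step(1) hull by blast
    ultimately show ?case
      using step(2) by (simp add: cfun.span_add cfun.span_scale cfun.span_base)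
  qed
  then have "?m ` family_hull X \<F> \<subseteq> family_hull X \<F>"
    unfolding family_hull_def by (intro closure_of_invariant[OF cont]) auto
  then show ?thesis
    using G by blast
qed

lemma family_subset_family_hull:
  assumes X: "fun_tvs X" "P3 X" and F: "F \<in> \<F>" "F \<in> topspace X"
  shows "F \<in> family_hull X \<F>"
proof -
  have "range (\<lambda>P z. eval2 P z * F z) \<subseteq> topspace X"
    using continuous_map_eval2_mult[OF X] F(2) by (fastforce simp: continuous_map_def)
  then have "range (\<lambda>P z. eval2 P z * F z) \<subseteq> invariant_hull X F"
    by (simp add: invariant_hull_def closure_of_subset)
  moreover have "F \<in> range (\<lambda>P z. eval2 P z * F z)"
    by (rule range_eqI[of _ _ 1]) simp
  ultimately have "F \<in> cfun.span (\<Union>F\<in>\<F>. invariant_hull X F)"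
    using F(1) by (intro cfun.span_base) blast
  then show ?thesis
    unfolding family_hull_def
    using closure_of_subset[OF span_hulls_subset_topspace[OF X(1)]] by blast
qed

section \<open>Points of the maximal domain\<close>

lemma domain_subset_max_domain: "P2 \<Omega> X \<Longrightarrow> \<Omega> \<subseteq> max_domain \<Omega> X"
  by (auto simp: max_domain_def P2_def continuous_functional_def fscale_def poly_fun_def
      intro!: exI[of _ "\<lambda>F. F _"])

text \<open>If multiplication by \<open>Q\<close> acts modulo a closed subspace as evaluation at \<open>w\<close> times \<open>Q\<close>,
  then the coefficient of \<open>Q\<close>, and hence evaluation at \<open>w\<close>, is continuous.\<close>

lemma max_domainI:
  assumes X: "fun_tvs X" "P1 \<Omega> X" "P3 X"
    and N: "closedin X N" "cfun.subspace N"
    and Q: "poly_fun \<Omega> Q \<notin> N"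
    and ev: "\<And>P. poly_fun \<Omega> ((P - [:[:eval2 P w:]:]) * Q) \<in> N"
  shows "w \<in> max_domain \<Omega> X"
proof -
  have QX: "poly_fun \<Omega> Q \<in> topspace X"
    using X(2) by (auto simp: P1_def)
  obtain U where U: "openin X U" "0 \<in> U"
    "\<And>c n. n \<in> N \<Longrightarrow> fscale c (poly_fun \<Omega> Q) + n \<in> U \<Longrightarrow> cmod c < 1"
    using closed_subspace_coefficient_bound[OF X(1) N QX Q] by metis
  \<comment> \<open>Multiplication by \<open>Q\<close> pulls \<open>U\<close> back to
    \<open>W\<close>, so the bound on the coefficient of \<open>Q\<close> becomes a bound on
    \<open>P(w)\<close>.\<close>
  define W where "W = {F \<in> topspace X. (\<lambda>z. eval2 Q z * F z) \<in> U}"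
  have W: "openin X W"
    unfolding W_def using continuous_map_eval2_mult[OF X(1,3)] U(1) openin_continuous_map_preimage
    by blast
  have W0: "0 \<in> W"
    using U(2) cfun.subspace_0[OF fun_tvs_subspace[OF X(1)]]
    by (simp add: W_def zero_fun_def)
  have bound: "cmod (eval2 P w) < 1" if "poly_fun \<Omega> P \<in> W" for P
  proof -
    have "(\<lambda>z. eval2 Q z * poly_fun \<Omega> P z) =
        fscale (eval2 P w) (poly_fun \<Omega> Q) + poly_fun \<Omega> ((P - [:[:eval2 P w:]:]) * Q)"
      by (auto simp: fscale_def fun_eq_iff poly_fun_def algebra_simps
          simp del: mult_pCons_left mult_pCons_right)
    with that show ?thesis
      using U(3)[OF ev, of "eval2 P w" P] by (simp add: W_def)
  qed
  \<comment> \<open>Well-definedness of \<open>l\<close>: a multiple of \<open>P - P'\<close> with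
    value \<open>1\<close> at \<open>w\<close> would represent \<open>0\<close>, which lies in
    \<open>W\<close>, contradicting \<open>bound\<close>.\<close>
  have wd: "eval2 P w = eval2 P' w" if "poly_fun \<Omega> P = poly_fun \<Omega> P'" for P P'
  proof (rule ccontr)
    assume ne: "eval2 P w \<noteq> eval2 P' w"
    define c where "c = 1 / (eval2 P w - eval2 P' w)"
    have "poly_fun \<Omega> ([:[:c:]:] * (P - P')) = 0"
      unfolding poly_fun_simps that by (auto simp: fscale_def fun_eq_iff)
    then have "cmod (eval2 ([:[:c:]:] * (P - P')) w) < 1"
      using W0 by (intro bound) simp
    then show False
      using ne unfolding eval2_simps by (simp add: c_def)
  qed
  define l where "l F = eval2 (SOME P. poly_fun \<Omega> P = F) w" for F
  have l: "l (poly_fun \<Omega> P) = eval2 P w" for P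
    unfolding l_def by (rule wd) (rule someI[of _ P], simp)
  obtain L where "continuous_functional X L" "\<And>F. F \<in> range (poly_fun \<Omega>) \<Longrightarrow> L F = l F"
  proof (rule dense_subspace_functional_extends[OF X(1) subspace_range_poly_fun[of \<Omega>] _ _ _ _ W W0])
    show "range (poly_fun \<Omega>) \<subseteq> topspace X" "X closure_of range (poly_fun \<Omega>) = topspace X"
      using X(2) by (auto simp: P1_def)
    show "l (F + G) = l F + l G" if FG: "F \<in> range (poly_fun \<Omega>)" "G \<in> range (poly_fun \<Omega>)" for F G
    proof -
      obtain P P' where "F = poly_fun \<Omega> P" "G = poly_fun \<Omega> P'"
        using FG by blast
      then show ?thesis
        using l[of "P + P'"] by (simp add: l poly_fun_simps)
    qed
    show "l (fscale c F) = c * l F" if F: "F \<in> range (poly_fun \<Omega>)" for c F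
    proof -
      obtain P where "F = poly_fun \<Omega> P"
        using F by blast
      then show ?thesis
        using l[of "[:[:c:]:] * P"] unfolding poly_fun_simps(3) eval2_simps by (simp add: l)
    qed
    show "cmod (l F) < 1" if "F \<in> range (poly_fun \<Omega>)" "F \<in> W" for F
      using that bound l by auto
  qed blast
  then show ?thesis
    by (auto simp: max_domain_def l)
qed

section \<open>Necessity of the two conditions\<close>

text \<open>At a common zero \<open>w\<close>, the kernel of the extended evaluation is a closed
  subspace that contains the family's hull but not \<open>1\<close>.\<close>

lemma jointly_cyclic_imp_no_zero:
  assumes X: "fun_tvs X" "P1 \<Omega> X"
    and jc: "jointly_cyclic X (poly_fun \<Omega> ` \<F>)"
  shows "zero_locus \<F> \<inter> max_domain \<Omega> X = {}"
proof (rule ccontr)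
  assume "\<not> ?thesis"
  then obtain w L where w: "w \<in> zero_locus \<F>" and L: "continuous_functional X L"
    and ev: "\<And>P. L (poly_fun \<Omega> P) = eval2 P w"
    by (auto simp: max_domain_def)
  define K where "K = {F \<in> topspace X. L F \<in> {0}}"
  have "closedin X K"
    unfolding K_def using L
    by (intro closedin_continuous_map_preimage) (auto simp: continuous_functional_def)
  moreover have "cfun.subspace K"
  proof -
    have "L 0 = 0"
      using L cfun.subspace_0[OF fun_tvs_subspace[OF X(1)]]
      by (metis continuous_functional_def cfun.scale_zero_left mult_zero_left)
    then show ?thesis
      using L fun_tvs_subspace[OF X(1)]
      by (auto simp: K_def cfun.subspace_def continuous_functional_def)
  qed
  moreover have "invariant_hull X F \<subseteq> K" if F: "F \<in> poly_fun \<Omega> ` \<F>" for F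
  proof (rule invariant_hull_least)
    fix P
    obtain f where f: "f \<in> \<F>" "F = poly_fun \<Omega> f"
      using F by blast
    then have "(\<lambda>z. eval2 P z * F z) = poly_fun \<Omega> (P * f)"
      by (simp add: poly_fun_simps)
    moreover have "poly_fun \<Omega> (P * f) \<in> K"
      using f w X(2) ev[of "P * f"] by (auto simp: K_def P1_def zero_locus_def)
    ultimately show "(\<lambda>z. eval2 P z * F z) \<in> K"
      by simp
  qed fact
  ultimately have "family_hull X (poly_fun \<Omega> ` \<F>) \<subseteq> K"
    by (rule family_hull_least)
  moreover have "poly_fun \<Omega> 1 \<in> topspace X" "poly_fun \<Omega> 1 \<notin> K"
    using X(2) ev[of 1] by (auto simp: P1_def K_def)
  ultimately show False
    using jc by (auto simp: jointly_cyclic_def)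
qed

text \<open>Every member is a multiple of the gcd, so the family's hull lies inside the hull of the
  gcd.\<close>

lemma jointly_cyclic_imp_cyclic_Gcd:
  assumes X: "fun_tvs X" "P1 \<Omega> X"
    and jc: "jointly_cyclic X (poly_fun \<Omega> ` \<F>)"
  shows "cyclic X (poly_fun \<Omega> (Gcd \<F>))"
proof -
  define g where "g = Gcd \<F>"
  let ?S = "range (\<lambda>P z. eval2 P z * poly_fun \<Omega> g z)"
  have S: "?S \<subseteq> topspace X"
    using X(2) by (auto simp: P1_def simp flip: poly_fun_simps)
  have "cfun.subspace ?S"
  proof (rule cfun.subspaceI)
    show "0 \<in> ?S"
      by (rule range_eqI[of _ _ 0]) auto
    show "F + G \<in> ?S" if FG: "F \<in> ?S" "G \<in> ?S" for F G
    proof -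
      obtain P P' where "F = poly_fun \<Omega> (P * g)" "G = poly_fun \<Omega> (P' * g)"
        using FG by (auto simp: poly_fun_simps)
      then have "F + G = poly_fun \<Omega> ((P + P') * g)"
        by (simp only: poly_fun_simps(1) distrib_right)
      then show ?thesis
        by (simp only: poly_fun_simps(2)) blast
    qed
    show "fscale c F \<in> ?S" if F: "F \<in> ?S" for c F
    proof -
      obtain P where "F = poly_fun \<Omega> (P * g)"
        using F by (auto simp: poly_fun_simps)
      then have "fscale c F = poly_fun \<Omega> (([:[:c:]:] * P) * g)"
        by (simp only: poly_fun_simps(3) mult.assoc)
      then show ?thesis
        by (simp only: poly_fun_simps(2)) blast
    qed
  qed
  then have "cfun.subspace (invariant_hull X (poly_fun \<Omega> g))"
    unfolding invariant_hull_def by (intro subspace_closure_of X S)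
  moreover have "closedin X (invariant_hull X (poly_fun \<Omega> g))"
    by (simp add: invariant_hull_def)
  moreover have "invariant_hull X F \<subseteq> invariant_hull X (poly_fun \<Omega> g)"
    if F: "F \<in> poly_fun \<Omega> ` \<F>" for F
  proof (rule invariant_hull_least)
    fix P
    obtain f where "f \<in> \<F>" "F = poly_fun \<Omega> f"
      using F by blast
    then obtain k where "F = poly_fun \<Omega> (k * g)"
      by (metis g_def Gcd_dvd dvd_def mult.commute)
    then have "(\<lambda>z. eval2 P z * F z) = (\<lambda>z. eval2 (P * k) z * poly_fun \<Omega> g z)"
      by (simp add: poly_fun_simps mult.assoc)
    then show "(\<lambda>z. eval2 P z * F z) \<in> invariant_hull X (poly_fun \<Omega> g)"
      unfolding invariant_hull_def using closure_of_subset[OF S] by blast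
  qed fact
  ultimately have "family_hull X (poly_fun \<Omega> ` \<F>) \<subseteq> invariant_hull X (poly_fun \<Omega> g)"
    by (intro family_hull_least)
  then show ?thesis
    using jc closure_of_subset_topspace
    by (fastforce simp: jointly_cyclic_def cyclic_def invariant_hull_def g_def)
qed

section \<open>Sufficiency, and the equivalence\<close>

lemma no_zero_and_cyclic_Gcd_imp_jointly_cyclic:
  assumes X: "fun_tvs X" "P1 \<Omega> X" "P2 \<Omega> X" "P3 X" and "\<Omega> \<noteq> {}"
    and zero: "zero_locus \<F> \<inter> max_domain \<Omega> X = {}"
    and cyc: "cyclic X (poly_fun \<Omega> (Gcd \<F>))"
  shows "jointly_cyclic X (poly_fun \<Omega> ` \<F>)"
proof (rule ccontr)
  assume not_jc: "\<not> ?thesis"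
  define g where "g = Gcd \<F>"
  define N where "N = family_hull X (poly_fun \<Omega> ` \<F>)"
  have N: "closedin X N" "cfun.subspace N"
    using X by (simp_all add: N_def closedin_family_hull subspace_family_hull)
  define J where "J = {P. poly_fun \<Omega> (P * g) \<in> N}"
  define S where "S = {f. f * g \<in> \<F>}"
  \<comment> \<open>Otherwise every point is a common zero, including those of the nonempty
    \<open>\<Omega>\<close>, which lies in the maximal domain.\<close>
  have "g \<noteq> 0"
  proof
    assume "g = 0"
    then have "\<F> \<subseteq> {0}"
      by (simp add: g_def)
    then have "zero_locus \<F> = UNIV"
      by (auto simp: zero_locus_def)
    then show False
      using zero domain_subset_max_domain[OF X(3)] \<open>\<Omega> \<noteq> {}\<close> by blast
  qed
  have S: "\<exists>k\<in>S. f = k * g" if "f \<in> \<F>" for f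
  proof -
    have "g dvd f"
      using Gcd_dvd[OF that] by (simp add: g_def)
    then obtain k where "f = k * g"
      by (metis dvdE mult.commute)
    with that show ?thesis
      by (auto simp: S_def)
  qed
  have "1 \<notin> J"
  proof
    assume "1 \<in> J"
    then have "invariant_hull X (poly_fun \<Omega> g) \<subseteq> N"
      using family_hull_eval2_mult[OF X(1,4)]
      by (intro invariant_hull_least N) (simp add: N_def J_def)
    then show False
      using not_jc cyc closedin_subset[OF N(1)]
      by (auto simp: jointly_cyclic_def cyclic_def N_def g_def)
  qed
  have mult: "Q * P \<in> J" if "P \<in> J" for P Q
    using family_hull_eval2_mult[OF X(1,4), of "poly_fun \<Omega> (P * g)" _ Q] that
    by (simp add: J_def N_def mult.assoc flip: poly_fun_simps(2))
  have add: "P + Q \<in> J" if "P \<in> J" "Q \<in> J" for P Q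
    using that N(2) by (simp add: J_def distrib_right poly_fun_simps(1) cfun.subspace_add)
  have sub: "S \<subseteq> J"
    using X by (auto simp: S_def J_def N_def P1_def intro!: family_subset_family_hull)
  \<comment> \<open>A common divisor \<open>d\<close> of the quotients makes \<open>d * g\<close> a
    common divisor of \<open>\<F>\<close>, hence a divisor of \<open>g\<close>.\<close>
  have unit: "d dvd 1" if d: "\<And>f. f \<in> S \<Longrightarrow> d dvd f" for d
  proof -
    have "d * g dvd g"
      using S d unfolding g_def by (intro Gcd_greatest) (fastforce intro: mult_dvd_mono)
    then show ?thesis
      using \<open>g \<noteq> 0\<close> by (metis dvd_mult_cancel_right mult_1)
  qed
  obtain w R where R: "R \<notin> J" "\<forall>P. (P - [:[:eval2 P w:]:]) * R \<in> J" and w: "w \<in> zero_locus J"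
    by (rule proper_ideal_associated_point[OF add mult sub unit \<open>1 \<notin> J\<close>]) blast
  have "w \<in> max_domain \<Omega> X"
    using R by (intro max_domainI[OF X(1,2,4) N, of "R * g"])
      (simp_all only: J_def mult.assoc mem_Collect_eq not_False_eq_True)
  moreover have "w \<in> zero_locus \<F>"
    using w sub S by (fastforce simp: zero_locus_def)
  ultimately show False
    using zero by blast
qed

theorem corollary3p9:
  fixes \<Omega> :: "(complex ^ 2) set" and X :: "cfun topology" and \<F> :: "poly2 set"
  assumes "open \<Omega>" and "\<Omega> \<noteq> {}"
    and "topspace X \<subseteq> Hol \<Omega>" and "fun_tvs X" and "Hausdorff_space X"
    and "P1 \<Omega> X" and "P2 \<Omega> X" and "P3 X"
  shows "(jointly_cyclic X (poly_fun \<Omega> ` \<F>) \<longleftrightarrow>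
            zero_locus \<F> \<inter> max_domain \<Omega> X = {} \<and> cyclic X (poly_fun \<Omega> (Gcd \<F>))) \<and>
         (Gcd \<F> = 1 \<longrightarrow>
            (jointly_cyclic X (poly_fun \<Omega> ` \<F>) \<longleftrightarrow> zero_locus \<F> \<inter> max_domain \<Omega> X = {}))"
proof -
  have iff: "jointly_cyclic X (poly_fun \<Omega> ` \<F>) \<longleftrightarrow>
      zero_locus \<F> \<inter> max_domain \<Omega> X = {} \<and> cyclic X (poly_fun \<Omega> (Gcd \<F>))"
    using jointly_cyclic_imp_no_zero jointly_cyclic_imp_cyclic_Gcd
      no_zero_and_cyclic_Gcd_imp_jointly_cyclic assms by blast
  \<comment> \<open>Cyclicity of \<open>1\<close> is the density of the polynomials.\<close>
  have "cyclic X (poly_fun \<Omega> 1)"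
    using \<open>P1 \<Omega> X\<close>
    by (simp add: cyclic_def invariant_hull_def P1_def flip: poly_fun_simps(2))
  with iff show ?thesis
    by simp
qed

end
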